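(* Let $X=[0,1]$, let $A=C(X,\mathbb K)$, let $\{t_i\}_{i\in\mathbb N}$ be a countable dense subset of $X$, and let $J=\{x\in A: fx\in A\}$, where $f:X\to\mathbb K$ is given by $f(t)=\sum_{i\in\mathbb N}\frac{1}{2^i}\chi_{[0,t_i]}(t)p_i$. Then the closed right ideal $J$ of $A$ is not topologically essential.
   Context: $H$ is a separable infinite-dimensional Hilbert space with a fixed orthonormal basis $\{e_i\}_{i\in\mathbb N}$ ($\mathbb N=\{1,2,\dots\}$), $\mathbb K$ is the $C^*$-algebra of compact operators on $H$, and $C(X,\mathbb K)$ is the $C^*$-algebra of norm-continuous $\mathbb K$-valued functions on $X$ with pointwise operations. $p_i$ is the rank one projection onto the span of $e_i$, and $\chi_E$ is the characteristic function of $E\subset X$. The product $fx$ is the pointwise product, $(fx)(t)=f(t)x(t)$; so $J$ consists of those $x\in A$ for which the function $fx$ is continuous, and it is a closed right ideal in $A$. A closed right ideal $J$ of a $C^*$-algebra $A$ is called topologically essential if $J\cap I\neq 0$ for every non-zero closed right ideal $I\subset A$. *)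

theory Defs
  imports "HOL-Analysis.Analysis"
begin

text \<open>Complex Hilbert spaces. The real Banach space structure of the superclass is the
  restriction of scalars of the complex one. The inner product is linear in its second argument.\<close>

class complex_hilbert = banach +
  fixes scaleC :: "complex \<Rightarrow> 'a \<Rightarrow> 'a"  (infixr "*\<^sub>C" 75)
    and cinner :: "'a \<Rightarrow> 'a \<Rightarrow> complex"
  assumes scaleC_add_right: "c *\<^sub>C (x + y) = c *\<^sub>C x + c *\<^sub>C y"
    and scaleC_add_left: "(c + d) *\<^sub>C x = c *\<^sub>C x + d *\<^sub>C x"
    and scaleC_scaleC: "c *\<^sub>C (d *\<^sub>C x) = (c * d) *\<^sub>C x"
    and scaleR_scaleC: "r *\<^sub>R x = complex_of_real r *\<^sub>C x"
    and cinner_commute: "cinner x y = cnj (cinner y x)"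
    and cinner_add_right: "cinner x (y + z) = cinner x y + cinner x z"
    and cinner_scaleC_right: "cinner x (c *\<^sub>C y) = c * cinner x y"
    and cinner_self_nonneg: "0 \<le> Re (cinner x x)"
    and norm_eq_sqrt_cinner: "norm x = sqrt (Re (cinner x x))"

lemma vector_space_scaleC: "vector_space (scaleC :: complex \<Rightarrow> 'h \<Rightarrow> 'h::complex_hilbert)"
proof
  show "1 *\<^sub>C x = x" for x :: 'h
    using scaleR_scaleC[of 1 x] by simp
qed (simp_all add: scaleC_add_right scaleC_add_left scaleC_scaleC)

lemma cinner_self: "cinner x x = complex_of_real ((norm (x::'h::complex_hilbert))\<^sup>2)"
proof -
  have "Im (cinner x x) = 0"
    using arg_cong[OF cinner_commute[of x x], of Im] by simp
  then show ?thesis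
    by (simp add: norm_eq_sqrt_cinner cinner_self_nonneg complex_eq_iff)
qed

lemma norm_scaleC: "norm (c *\<^sub>C (x::'h::complex_hilbert)) = cmod c * norm x"
proof -
  have "cinner (c *\<^sub>C x) (c *\<^sub>C x) = c * cnj c * cinner x x"
    using cinner_commute[of "c *\<^sub>C x" x]
    by (simp add: cinner_scaleC_right flip: cinner_commute)
  also have "\<dots> = complex_of_real ((cmod c * norm x)\<^sup>2)"
    by (simp add: cinner_self power_mult_distrib flip: complex_norm_square)
  finally have "(norm (c *\<^sub>C x))\<^sup>2 = (cmod c * norm x)\<^sup>2"
    by (simp only: cinner_self of_real_eq_iff)
  then show ?thesis
    by (simp add: power2_eq_iff_nonneg)
qed

lemma Re_cinner_le: "Re (cinner x y) \<le> norm x * norm (y::'h::complex_hilbert)"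
proof (cases "x = 0 \<or> y = 0")
  case True
  have "cinner x 0 = 0" using cinner_add_right[of x 0 0] by simp
  moreover have "cinner 0 y = 0"
    using cinner_add_right[of y 0 0] cinner_commute[of 0 y] by simp
  ultimately show ?thesis using True by auto
next
  case False
  have cross: "(norm (u + v))\<^sup>2 = (norm u)\<^sup>2 + (norm v)\<^sup>2 + 2 * Re (cinner u v)" for u v :: 'h
  proof -
    have left: "cinner (u + v) w = cinner u w + cinner v w" for w
      by (metis cinner_add_right cinner_commute complex_cnj_add)
    have "Re (cinner (u + v) (u + v))
        = Re (cinner u u) + Re (cinner u v) + (Re (cinner v u) + Re (cinner v v))"
      by (simp add: left cinner_add_right)
    moreover have "Re (cinner v u) = Re (cinner u v)"
      by (subst cinner_commute) simp
    ultimately show ?thesis by (simp add: cinner_self)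
  qed
  have "(norm (x + y))\<^sup>2 \<le> (norm x + norm y)\<^sup>2"
    by (intro power_mono norm_triangle_ineq) simp
  then show ?thesis
    by (simp add: cross power2_sum)
qed

lemma norm_cinner_le: "cmod (cinner x y) \<le> norm x * norm (y::'h::complex_hilbert)"
proof -
  obtain u where u: "cmod u = 1" "u * cinner x y = of_real (cmod (cinner x y))"
  proof (cases "cinner x y = 0")
    case True
    then show ?thesis using that[of 1] by simp
  next
    case False
    let ?z = "cinner x y"
    have "cnj ?z / cmod ?z * ?z = of_real (cmod ?z)"
      using False complex_norm_square[of ?z]
      by (simp add: field_simps power2_eq_square)
    moreover have "cmod (cnj ?z / cmod ?z) = 1"
      using False by (simp add: norm_divide)
    ultimately show ?thesis using that by blast
  qed
  have "cmod (cinner x y) = Re (cinner x (u *\<^sub>C y))"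
    by (simp add: cinner_scaleC_right u)
  also have "\<dots> \<le> norm x * norm (u *\<^sub>C y)" by (rule Re_cinner_le)
  finally show ?thesis by (simp add: norm_scaleC u)
qed

text \<open>Separability and infinite dimension are implied by the existence of a basis indexed by
  \<^typ>\<open>nat\<close>.\<close>

definition orthonormal_basis :: "(nat \<Rightarrow> 'h::complex_hilbert) \<Rightarrow> bool" where
  "orthonormal_basis e \<longleftrightarrow>
     (\<forall>i j. cinner (e i) (e j) = (if i = j then 1 else 0)) \<and>
     closure (module.span scaleC (range e)) = UNIV"

text \<open>Operators live in the library type of bounded real-linear maps, whose norm is the operator
  norm; complex linearity is therefore required explicitly.\<close>

definition compact_operators :: "('h::complex_hilbert \<Rightarrow>\<^sub>L 'h) set" where
  "compact_operators =
     {T. Vector_Spaces.linear scaleC scaleC (blinfun_apply T) \<and>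
         compact (closure (blinfun_apply T ` cball 0 1))}"

definition op_scaleC :: "complex \<Rightarrow> ('h::complex_hilbert \<Rightarrow>\<^sub>L 'h) \<Rightarrow> 'h \<Rightarrow>\<^sub>L 'h" where
  "op_scaleC c T = Blinfun (\<lambda>v. c *\<^sub>C blinfun_apply T v)"

lemma op_scaleC_apply: "blinfun_apply (op_scaleC c T) v = c *\<^sub>C blinfun_apply T v"
proof -
  have "bounded_linear (\<lambda>v. c *\<^sub>C v :: 'a)"
    by (rule bounded_linear_intro[where K = "cmod c"])
       (simp_all add: scaleC_add_right scaleR_scaleC scaleC_scaleC norm_scaleC mult.commute)
  then have "bounded_linear (\<lambda>v. c *\<^sub>C blinfun_apply T v)"
    by (rule bounded_linear_compose) (rule blinfun.bounded_linear_right)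
  then show ?thesis
    by (simp add: op_scaleC_def bounded_linear_Blinfun_apply)
qed

text \<open>For a unit vector this is the orthogonal projection onto its span.\<close>

definition rank_one_proj :: "'h::complex_hilbert \<Rightarrow> 'h \<Rightarrow>\<^sub>L 'h" where
  "rank_one_proj u = Blinfun (\<lambda>v. cinner u v *\<^sub>C u)"

lemma rank_one_proj_apply: "blinfun_apply (rank_one_proj u) v = cinner u v *\<^sub>C u"
proof -
  have "bounded_linear (\<lambda>v. cinner u v *\<^sub>C u)"
  proof (rule bounded_linear_intro[where K = "norm u * norm u"])
    show "norm (cinner u v *\<^sub>C u) \<le> norm v * (norm u * norm u)" for v
      using mult_right_mono[OF norm_cinner_le[of u v], of "norm u"]
      by (simp add: norm_scaleC mult_ac)
  qed (simp_all add: cinner_add_right scaleC_add_left scaleR_scaleC cinner_scaleC_right scaleC_scaleC)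
  then show ?thesis
    by (simp add: rank_one_proj_def bounded_linear_Blinfun_apply)
qed

text \<open>Elements of \<open>C(X, K)\<close> are represented by functions on the ambient type that vanish
  outside \<open>X\<close>, so that each element has exactly one representative and the algebra operations
  are pointwise.\<close>

definition C_K :: "'x::topological_space set \<Rightarrow> ('x \<Rightarrow> 'h::complex_hilbert \<Rightarrow>\<^sub>L 'h) set" where
  "C_K X = {x. continuous_on X x \<and> (\<forall>t\<in>X. x t \<in> compact_operators) \<and> (\<forall>t. t \<notin> X \<longrightarrow> x t = 0)}"

text \<open>Convergence in the supremum norm of \<open>C(X, K)\<close> is uniform convergence on \<open>X\<close>.\<close>

definition closed_right_ideal ::
    "'x::topological_space set \<Rightarrow> ('x \<Rightarrow> 'h::complex_hilbert \<Rightarrow>\<^sub>L 'h) set \<Rightarrow> bool" where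
  "closed_right_ideal X I \<longleftrightarrow>
     I \<subseteq> C_K X \<and>
     (\<lambda>t. 0) \<in> I \<and>
     (\<forall>x\<in>I. \<forall>y\<in>I. (\<lambda>t. x t + y t) \<in> I) \<and>
     (\<forall>c. \<forall>x\<in>I. (\<lambda>t. op_scaleC c (x t)) \<in> I) \<and>
     (\<forall>x\<in>I. \<forall>a\<in>C_K X. (\<lambda>t. x t o\<^sub>L a t) \<in> I) \<and>
     (\<forall>s x. (\<forall>n. s n \<in> I) \<and> x \<in> C_K X \<and> uniform_limit X s x sequentially \<longrightarrow> x \<in> I)"

definition topologically_essential ::
    "'x::topological_space set \<Rightarrow> ('x \<Rightarrow> 'h::complex_hilbert \<Rightarrow>\<^sub>L 'h) set \<Rightarrow> bool" where
  "topologically_essential X J \<longleftrightarrow>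
     (\<forall>I. closed_right_ideal X I \<and> I \<noteq> {\<lambda>t. 0} \<longrightarrow> J \<inter> I \<noteq> {\<lambda>t. 0})"

end

theory Submission
  imports Defs
begin

text \<open>
  Taking coordinates turns membership in \<open>J\<close> into a vanishing condition. Since
  \<open>\<langle>e\<^sub>i, f(t) w\<rangle> = 2\<^sup>-\<^sup>i\<^sup>-\<^sup>1 \<chi>(t) \<langle>e\<^sub>i, w\<rangle>\<close> for all \<open>w\<close>, where \<open>\<chi>\<close> is the characteristic
  function of \<open>[0, \<tau>\<^sub>i]\<close>, the \<open>i\<close>-th coordinate of \<open>f x v\<close> is zero just to the right of \<open>\<tau>\<^sub>i\<close>, and so
  continuity of \<open>f x\<close> forces \<open>\<langle>e\<^sub>i, x(\<tau>\<^sub>i) v\<rangle> = 0\<close> for all \<open>v\<close> as soon as \<open>\<tau>\<^sub>i < 1\<close>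
  (\<open>cinner_rank_one_proj_diagonal\<close>, \<open>coordinate_zero_at_jump\<close>).

  Each \<open>\<tau>\<^sub>i\<close> thus imposes a condition in the single direction \<open>e\<^sub>i\<close>. To meet all of these conditions
  at once, take a unit vector \<open>u\<close> none of whose coordinates is zero
  (\<open>unit_vector_all_coordinates\<close>), let \<open>P\<close> be the projection onto its span, and let \<open>I\<close> consist of
  the \<open>x\<close> with \<open>P x = x\<close>. If \<open>x\<close> is in both \<open>I\<close> and \<open>J\<close>, then \<open>x(\<tau>\<^sub>i) v\<close> is a multiple of \<open>u\<close> whose
  \<open>i\<close>-th coordinate is zero, so \<open>x(\<tau>\<^sub>i) = 0\<close>. The points \<open>\<tau>\<^sub>i < 1\<close> are still dense, whence \<open>x = 0\<close>.
  But \<open>I\<close> contains the function with constant value \<open>P\<close> on \<open>X\<close>, so it is not zero.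

  That \<open>J\<close> is a closed right ideal holds for every bounded \<open>f\<close> with complex linear values, however
  discontinuous (\<open>closed_right_ideal_continuous_product\<close>).
\<close>

section \<open>Complex linear and compact operators\<close>

lemma bounded_linear_scaleC_right: "bounded_linear (\<lambda>v::'h::complex_hilbert. c *\<^sub>C v)"
  by (rule bounded_linear_intro[where K = "cmod c"])
     (simp_all add: scaleC_add_right scaleR_scaleC scaleC_scaleC norm_scaleC mult.commute)

lemma bounded_linear_scaleC_left: "bounded_linear (\<lambda>c. c *\<^sub>C (v::'h::complex_hilbert))"
  by (rule bounded_linear_intro[where K = "norm v"])
     (simp_all add: scaleC_add_left scaleR_scaleC scaleC_scaleC norm_scaleC scaleR_conv_of_real)

lemma bounded_linear_cinner_right: "bounded_linear (cinner (u::'h::complex_hilbert))"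
  by (rule bounded_linear_intro[where K = "norm u"])
     (simp_all add: cinner_add_right scaleR_scaleC cinner_scaleC_right scaleR_conv_of_real
        norm_cinner_le mult.commute[of "norm _" "norm u"])

lemma complex_linear_blinfun_iff:
  "Vector_Spaces.linear scaleC scaleC (blinfun_apply (T :: 'h::complex_hilbert \<Rightarrow>\<^sub>L 'h))
    \<longleftrightarrow> (\<forall>c v. blinfun_apply T (c *\<^sub>C v) = c *\<^sub>C blinfun_apply T v)"
  using vector_space_scaleC[where 'h = 'h]
  by (auto simp: Vector_Spaces.linear_iff blinfun.add_right)

lemma compact_operators_scaleC:
  "T \<in> compact_operators \<Longrightarrow> blinfun_apply T (c *\<^sub>C v) = c *\<^sub>C blinfun_apply T v"
  by (simp add: compact_operators_def complex_linear_blinfun_iff)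

lemma compact_operatorsI:
  fixes T :: "'h::complex_hilbert \<Rightarrow>\<^sub>L 'h"
  assumes "\<And>c v. blinfun_apply T (c *\<^sub>C v) = c *\<^sub>C blinfun_apply T v"
    and "compact K" and "blinfun_apply T ` cball 0 1 \<subseteq> K"
  shows "T \<in> compact_operators"
proof -
  have "closure (blinfun_apply T ` cball 0 1) \<subseteq> K"
    using assms(2,3) by (simp add: closure_minimal compact_imp_closed)
  then have "compact (closure (blinfun_apply T ` cball 0 1))"
    using assms(2) by (metis closed_closure compact_Int_closed inf.absorb_iff2)
  then show ?thesis
    using assms(1) by (simp add: compact_operators_def complex_linear_blinfun_iff)
qed

lemma compact_operatorsE:
  fixes T :: "'h::complex_hilbert \<Rightarrow>\<^sub>L 'h"
  assumes "T \<in> compact_operators"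
  obtains K where "compact K" and "blinfun_apply T ` cball 0 1 \<subseteq> K"
proof (rule that)
  show "compact (closure (blinfun_apply T ` cball 0 1))"
    using assms by (simp add: compact_operators_def)
qed (rule closure_subset)

lemma blinfun_compose_assoc: "(S o\<^sub>L T) o\<^sub>L U = S o\<^sub>L (T o\<^sub>L U)"
  by (rule blinfun_eqI) simp

lemma zero_in_compact_operators: "0 \<in> compact_operators"
proof (rule compact_operatorsI[where K = "{0}"])
  show "blinfun_apply 0 (c *\<^sub>C v) = c *\<^sub>C blinfun_apply 0 v" for c and v :: 'a
    using linear_0[OF bounded_linear.linear[OF bounded_linear_scaleC_right]] by simp
qed auto

lemma compact_operators_add:
  fixes S T :: "'h::complex_hilbert \<Rightarrow>\<^sub>L 'h"
  assumes S: "S \<in> compact_operators" and T: "T \<in> compact_operators"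
  shows "S + T \<in> compact_operators"
proof -
  obtain K L where "compact K" "blinfun_apply S ` cball 0 1 \<subseteq> K"
      and "compact L" "blinfun_apply T ` cball 0 1 \<subseteq> L"
    using S T by (metis compact_operatorsE)
  then show ?thesis
    by (intro compact_operatorsI[where K = "{a + b |a b. a \<in> K \<and> b \<in> L}"] compact_sums)
       (auto simp: blinfun.add_left compact_operators_scaleC S T scaleC_add_right image_subset_iff)
qed

lemma compact_operators_compose_left:
  fixes S T :: "'h::complex_hilbert \<Rightarrow>\<^sub>L 'h"
  assumes S: "\<And>c v. blinfun_apply S (c *\<^sub>C v) = c *\<^sub>C blinfun_apply S v"
    and T: "T \<in> compact_operators"
  shows "S o\<^sub>L T \<in> compact_operators"
proof -
  obtain K where K: "compact K" "blinfun_apply T ` cball 0 1 \<subseteq> K"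
    using T by (rule compact_operatorsE)
  have "compact (blinfun_apply S ` K)"
    using K(1) by (intro compact_continuous_image continuous_intros)
  then show ?thesis
    by (rule compact_operatorsI[rotated]) (use K(2) in \<open>auto simp: compact_operators_scaleC S T\<close>)
qed

lemma op_scaleC_eq_compose: "op_scaleC c T = op_scaleC c id_blinfun o\<^sub>L T"
  by (rule blinfun_eqI) (simp add: op_scaleC_apply)

lemma op_scaleC_id_commute:
  "blinfun_apply (op_scaleC c id_blinfun) (d *\<^sub>C v) = d *\<^sub>C blinfun_apply (op_scaleC c id_blinfun) v"
  by (simp add: op_scaleC_apply scaleC_scaleC mult.commute)

lemma compose_op_scaleC:
  fixes S T :: "'h::complex_hilbert \<Rightarrow>\<^sub>L 'h"
  assumes "\<And>c v. blinfun_apply S (c *\<^sub>C v) = c *\<^sub>C blinfun_apply S v"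
  shows "S o\<^sub>L op_scaleC c T = op_scaleC c (S o\<^sub>L T)"
  by (rule blinfun_eqI) (simp add: op_scaleC_apply assms)

lemma rank_one_proj_scaleC:
  "blinfun_apply (rank_one_proj u) (c *\<^sub>C v) = c *\<^sub>C blinfun_apply (rank_one_proj u) v"
  by (simp add: rank_one_proj_apply cinner_scaleC_right scaleC_scaleC)

lemma norm_rank_one_proj_le:
  fixes u :: "'h::complex_hilbert"
  shows "norm (rank_one_proj u) \<le> norm u * norm u"
proof (rule norm_blinfun_bound)
  show "norm (blinfun_apply (rank_one_proj u) v) \<le> norm u * norm u * norm v" for v
    using mult_right_mono[OF norm_cinner_le[of u v], of "norm u"]
    by (simp add: rank_one_proj_apply norm_scaleC mult_ac)
qed simp

lemma rank_one_proj_compact: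
  fixes u :: "'h::complex_hilbert"
  shows "rank_one_proj u \<in> compact_operators"
proof (rule compact_operatorsI[OF rank_one_proj_scaleC])
  show "compact ((\<lambda>c. c *\<^sub>C u) ` cball 0 (norm u))"
    by (intro compact_continuous_image linear_continuous_on bounded_linear_scaleC_left) simp
  have "cmod (cinner u v) \<le> norm u" if "norm v \<le> 1" for v
    using norm_cinner_le[of u v] mult_left_mono[OF that, of "norm u"] by simp
  then show "blinfun_apply (rank_one_proj u) ` cball 0 1 \<subseteq> (\<lambda>c. c *\<^sub>C u) ` cball 0 (norm u)"
    by (auto simp: rank_one_proj_apply)
qed

section \<open>Closed right ideals in the algebra of compact operator valued functions\<close>

lemma C_K_zero: "(\<lambda>t. 0) \<in> C_K X"
  by (simp add: C_K_def zero_in_compact_operators)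

lemma C_K_add: "x \<in> C_K X \<Longrightarrow> y \<in> C_K X \<Longrightarrow> (\<lambda>t. x t + y t) \<in> C_K X"
  by (auto simp: C_K_def intro: continuous_on_add compact_operators_add)

lemma C_K_mult: "x \<in> C_K X \<Longrightarrow> y \<in> C_K X \<Longrightarrow> (\<lambda>t. x t o\<^sub>L y t) \<in> C_K X"
  by (auto simp: C_K_def intro: bounded_bilinear.continuous_on[OF bounded_bilinear_blinfun_compose]
      compact_operators_compose_left compact_operators_scaleC)

lemma C_K_scaleC:
  assumes "x \<in> C_K X"
  shows "(\<lambda>t. op_scaleC c (x t)) \<in> C_K X"
proof -
  have "continuous_on X (\<lambda>t. op_scaleC c id_blinfun o\<^sub>L x t)"
    using assms by (intro bounded_bilinear.continuous_on[OF bounded_bilinear_blinfun_compose])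
      (simp_all add: C_K_def)
  then show ?thesis
    unfolding op_scaleC_eq_compose[of c "x _"]
    using assms by (auto simp: C_K_def op_scaleC_id_commute intro!: compact_operators_compose_left)
qed

text \<open>Uniform boundedness of \<open>f\<close> makes left multiplication by \<open>f\<close> preserve uniform limits; the
  values of the product are compact for algebraic reasons, so only continuity has to survive the
  limit.\<close>

lemma closed_right_ideal_continuous_product:
  fixes f :: "'x::topological_space \<Rightarrow> 'h::complex_hilbert \<Rightarrow>\<^sub>L 'h"
  assumes bound: "\<And>t. t \<in> X \<Longrightarrow> norm (f t) \<le> B"
    and lin: "\<And>t c v. t \<in> X \<Longrightarrow> blinfun_apply (f t) (c *\<^sub>C v) = c *\<^sub>C blinfun_apply (f t) v"
  shows "closed_right_ideal X {x \<in> C_K X. (\<lambda>t. f t o\<^sub>L x t) \<in> C_K X}"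
  unfolding closed_right_ideal_def
proof (intro conjI ballI allI impI; (elim conjE)?)
  show "(\<lambda>t. 0) \<in> {x \<in> C_K X. (\<lambda>t. f t o\<^sub>L x t) \<in> C_K X}"
    by (simp add: C_K_zero)
next
  fix x y
  assume "x \<in> {x \<in> C_K X. (\<lambda>t. f t o\<^sub>L x t) \<in> C_K X}"
    and "y \<in> {x \<in> C_K X. (\<lambda>t. f t o\<^sub>L x t) \<in> C_K X}"
  then show "(\<lambda>t. x t + y t) \<in> {x \<in> C_K X. (\<lambda>t. f t o\<^sub>L x t) \<in> C_K X}"
    using C_K_add[of "\<lambda>t. f t o\<^sub>L x t" X "\<lambda>t. f t o\<^sub>L y t"]
    by (simp add: C_K_add bounded_bilinear.add_right[OF bounded_bilinear_blinfun_compose])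
next
  fix c x assume x: "x \<in> {x \<in> C_K X. (\<lambda>t. f t o\<^sub>L x t) \<in> C_K X}"
  have "(\<lambda>t. f t o\<^sub>L op_scaleC c (x t)) = (\<lambda>t. op_scaleC c (f t o\<^sub>L x t))"
  proof
    fix t
    show "f t o\<^sub>L op_scaleC c (x t) = op_scaleC c (f t o\<^sub>L x t)"
    proof (cases "t \<in> X")
      case True
      then show ?thesis by (intro compose_op_scaleC lin)
    next
      case False
      then have "x t = 0" using x by (simp add: C_K_def)
      then show ?thesis by (simp add: op_scaleC_eq_compose[of c 0])
    qed
  qed
  then show "(\<lambda>t. op_scaleC c (x t)) \<in> {x \<in> C_K X. (\<lambda>t. f t o\<^sub>L x t) \<in> C_K X}"
    using x by (simp add: C_K_scaleC)
next
  fix x and a :: "'x \<Rightarrow> 'h \<Rightarrow>\<^sub>L 'h"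
  assume "x \<in> {x \<in> C_K X. (\<lambda>t. f t o\<^sub>L x t) \<in> C_K X}" and "a \<in> C_K X"
  then show "(\<lambda>t. x t o\<^sub>L a t) \<in> {x \<in> C_K X. (\<lambda>t. f t o\<^sub>L x t) \<in> C_K X}"
    using C_K_mult[of "\<lambda>t. f t o\<^sub>L x t" X a] by (simp add: C_K_mult blinfun_compose_assoc)
next
  fix s x
  assume s: "\<forall>n. s n \<in> {x \<in> C_K X. (\<lambda>t. f t o\<^sub>L x t) \<in> C_K X}"
    and x: "x \<in> C_K X" and lim: "uniform_limit X s x sequentially"
  have "\<forall>\<^sub>F n in sequentially. \<forall>t\<in>X. norm (s n t - x t) < \<epsilon> / (\<bar>B\<bar> + 1)" if "\<epsilon> > 0" for \<epsilon>
    using lim that by (simp add: uniform_limit_iff dist_norm)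
  moreover have "norm ((f t o\<^sub>L s n t) - (f t o\<^sub>L x t)) < \<epsilon>"
    if "t \<in> X" "norm (s n t - x t) < \<epsilon> / (\<bar>B\<bar> + 1)" for \<epsilon> n t
  proof -
    have "norm ((f t o\<^sub>L s n t) - (f t o\<^sub>L x t)) \<le> norm (f t) * norm (s n t - x t)"
      by (metis norm_blinfun_compose bounded_bilinear.diff_right[OF bounded_bilinear_blinfun_compose])
    also have "\<dots> \<le> (\<bar>B\<bar> + 1) * norm (s n t - x t)"
      using bound[OF that(1)] by (intro mult_right_mono) auto
    also have "\<dots> < \<epsilon>"
      using that(2) by (simp add: pos_less_divide_eq mult.commute)
    finally show ?thesis .
  qed
  ultimately have "uniform_limit X (\<lambda>n t. f t o\<^sub>L s n t) (\<lambda>t. f t o\<^sub>L x t) sequentially"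
    unfolding uniform_limit_iff dist_norm by (smt (verit, best) eventually_mono)
  then have "continuous_on X (\<lambda>t. f t o\<^sub>L x t)"
    by (rule uniform_limit_theorem[rotated]) (use s in \<open>auto simp: C_K_def\<close>)
  then show "x \<in> {x \<in> C_K X. (\<lambda>t. f t o\<^sub>L x t) \<in> C_K X}"
    using x by (auto simp: C_K_def lin intro!: compact_operators_compose_left)
qed auto

text \<open>If \<open>P\<close> is the projection onto a line, these are the functions all of whose values have range
  in that line.\<close>

lemma closed_right_ideal_fixed_by_left_mult:
  fixes P :: "'h::complex_hilbert \<Rightarrow>\<^sub>L 'h" and X :: "'x::topological_space set"
  assumes lin: "\<And>c v. blinfun_apply P (c *\<^sub>C v) = c *\<^sub>C blinfun_apply P v"
  shows "closed_right_ideal X {x \<in> C_K X. \<forall>t\<in>X. P o\<^sub>L x t = x t}"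
  unfolding closed_right_ideal_def
proof (intro conjI ballI allI impI; (elim conjE)?)
  fix s x
  assume s: "\<forall>n. s n \<in> {x \<in> C_K X. \<forall>t\<in>X. P o\<^sub>L x t = x t}"
    and x: "x \<in> C_K X" and lim: "uniform_limit X s x sequentially"
  have "P o\<^sub>L x t = x t" if t: "t \<in> X" for t
  proof (rule LIMSEQ_unique)
    show st: "(\<lambda>n. s n t) \<longlonglongrightarrow> x t"
      using lim t by (rule tendsto_uniform_limitI)
    have "(\<lambda>n. P o\<^sub>L s n t) \<longlonglongrightarrow> (P o\<^sub>L x t)"
      by (intro bounded_bilinear.tendsto[OF bounded_bilinear_blinfun_compose] tendsto_const st)
    then show "(\<lambda>n. s n t) \<longlonglongrightarrow> (P o\<^sub>L x t)"
      using s t by simp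
  qed
  then show "x \<in> {x \<in> C_K X. \<forall>t\<in>X. P o\<^sub>L x t = x t}"
    using x by simp
qed (auto simp: C_K_zero C_K_add C_K_scaleC C_K_mult bounded_bilinear.add_right[OF bounded_bilinear_blinfun_compose]
    compose_op_scaleC[OF lin] simp flip: blinfun_compose_assoc)

section \<open>Vectors and coordinates in an orthonormal system\<close>

text \<open>Any absolutely convergent combination of the \<open>e\<^sub>i\<close> with nonzero coefficients has this
  property once it is normalised; a geometric series is the simplest.\<close>

lemma unit_vector_all_coordinates:
  fixes e :: "nat \<Rightarrow> 'h::complex_hilbert"
  assumes orth: "\<And>i j. cinner (e i) (e j) = (if i = j then 1 else 0)"
  obtains u where "norm u = 1" and "\<And>i. cinner (e i) u \<noteq> 0"
proof -
  have norm_e: "norm (e i) = 1" for i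
    using orth[of i i] by (simp add: norm_eq_sqrt_cinner)
  define w where "w = (\<Sum>i. (1 / 2) ^ i *\<^sub>R e i)"
  have "summable (\<lambda>i. (1 / 2 :: real) ^ i)"
    by (rule summable_geometric) simp
  then have "summable (\<lambda>i. norm ((1 / 2) ^ i *\<^sub>R e i))"
    by (simp add: norm_e power_divide)
  then have w: "(\<lambda>i. (1 / 2) ^ i *\<^sub>R e i) sums w"
    unfolding w_def by (rule summable_sums[OF summable_norm_cancel])
  have coord: "cinner (e j) w = (1 / 2) ^ j" for j
  proof (rule sums_unique2)
    show "(\<lambda>i. cinner (e j) ((1 / 2) ^ i *\<^sub>R e i)) sums cinner (e j) w"
      using bounded_linear_cinner_right w by (rule bounded_linear.sums)
    have "(\<lambda>i. cinner (e j) ((1 / 2) ^ i *\<^sub>R e i)) = (\<lambda>i. if i = j then (1 / 2) ^ i else 0)"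
      by (auto simp: scaleR_scaleC cinner_scaleC_right orth)
    then show "(\<lambda>i. cinner (e j) ((1 / 2) ^ i *\<^sub>R e i)) sums (1 / 2) ^ j"
      using sums_single[of j "\<lambda>i. (1 / 2 :: complex) ^ i"] by simp
  qed
  have "w \<noteq> 0"
  proof
    assume "w = 0"
    then have "cinner (e 0) w = 0"
      using linear_0[OF bounded_linear.linear[OF bounded_linear_cinner_right[of "e 0"]]] by simp
    then show False using coord[of 0] by simp
  qed
  then have "norm ((1 / norm w) *\<^sub>R w) = 1" and "\<And>i. cinner (e i) ((1 / norm w) *\<^sub>R w) \<noteq> 0"
    by (simp_all add: scaleR_scaleC cinner_scaleC_right coord norm_scaleC norm_divide)
  then show ?thesis by (rule that)
qed

lemma rank_one_proj_diagonal_sums: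
  fixes e :: "nat \<Rightarrow> 'h::complex_hilbert" and a :: "nat \<Rightarrow> real"
  assumes norm_e: "\<And>i. norm (e i) = 1" and a: "summable (\<lambda>i. \<bar>a i\<bar>)"
  shows "summable (\<lambda>i. norm (a i *\<^sub>R rank_one_proj (e i)))"
    and "norm (\<Sum>i. a i *\<^sub>R rank_one_proj (e i)) \<le> (\<Sum>i. \<bar>a i\<bar>)"
    and "blinfun_apply (\<Sum>i. a i *\<^sub>R rank_one_proj (e i)) (c *\<^sub>C v)
      = c *\<^sub>C blinfun_apply (\<Sum>i. a i *\<^sub>R rank_one_proj (e i)) v"
proof -
  have le: "norm (a i *\<^sub>R rank_one_proj (e i)) \<le> \<bar>a i\<bar>" for i
    using norm_rank_one_proj_le[of "e i"] mult_left_mono[of "norm (rank_one_proj (e i))" 1 "\<bar>a i\<bar>"]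
    by (simp add: norm_e)
  show norm_summable: "summable (\<lambda>i. norm (a i *\<^sub>R rank_one_proj (e i)))"
    by (rule summable_comparison_test'[OF a, of 0]) (use le in simp)
  have "norm (\<Sum>i. a i *\<^sub>R rank_one_proj (e i)) \<le> (\<Sum>i. norm (a i *\<^sub>R rank_one_proj (e i)))"
    using norm_summable by (rule summable_norm)
  also have "\<dots> \<le> (\<Sum>i. \<bar>a i\<bar>)"
    using le norm_summable a by (rule suminf_le)
  finally show "norm (\<Sum>i. a i *\<^sub>R rank_one_proj (e i)) \<le> (\<Sum>i. \<bar>a i\<bar>)" .
  have apply_sums: "(\<lambda>i. a i *\<^sub>R blinfun_apply (rank_one_proj (e i)) w)
      sums blinfun_apply (\<Sum>i. a i *\<^sub>R rank_one_proj (e i)) w" for w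
    using bounded_linear.sums[OF blinfun.bounded_linear_left[of w]
        summable_sums[OF summable_norm_cancel[OF norm_summable]]]
    by (simp add: blinfun.scaleR_left)
  have "(\<lambda>i. c *\<^sub>C (a i *\<^sub>R blinfun_apply (rank_one_proj (e i)) v))
      sums (c *\<^sub>C blinfun_apply (\<Sum>i. a i *\<^sub>R rank_one_proj (e i)) v)"
    using bounded_linear_scaleC_right apply_sums by (rule bounded_linear.sums)
  moreover have "c *\<^sub>C (a i *\<^sub>R blinfun_apply (rank_one_proj (e i)) v)
      = a i *\<^sub>R blinfun_apply (rank_one_proj (e i)) (c *\<^sub>C v)" for i
    by (simp add: rank_one_proj_scaleC scaleR_scaleC scaleC_scaleC mult.commute)
  ultimately show "blinfun_apply (\<Sum>i. a i *\<^sub>R rank_one_proj (e i)) (c *\<^sub>C v)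
      = c *\<^sub>C blinfun_apply (\<Sum>i. a i *\<^sub>R rank_one_proj (e i)) v"
    using apply_sums[of "c *\<^sub>C v"] by (simp add: sums_unique2)
qed

lemma cinner_rank_one_proj_diagonal:
  fixes e :: "nat \<Rightarrow> 'h::complex_hilbert" and a :: "nat \<Rightarrow> real"
  assumes orth: "\<And>i j. cinner (e i) (e j) = (if i = j then 1 else 0)"
    and a: "summable (\<lambda>i. \<bar>a i\<bar>)"
  shows "cinner (e j) (blinfun_apply (\<Sum>i. a i *\<^sub>R rank_one_proj (e i)) v)
    = of_real (a j) * cinner (e j) v"
proof (rule sums_unique2)
  have norm_e: "norm (e i) = 1" for i
    using orth[of i i] by (simp add: norm_eq_sqrt_cinner)
  have "bounded_linear (\<lambda>T. cinner (e j) (blinfun_apply T v))"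
    by (rule bounded_linear_compose[OF bounded_linear_cinner_right blinfun.bounded_linear_left])
  then show "(\<lambda>i. cinner (e j) (blinfun_apply (a i *\<^sub>R rank_one_proj (e i)) v))
      sums cinner (e j) (blinfun_apply (\<Sum>i. a i *\<^sub>R rank_one_proj (e i)) v)"
    by (rule bounded_linear.sums[OF _ summable_sums[OF summable_norm_cancel]])
       (rule rank_one_proj_diagonal_sums(1)[OF norm_e a])
  have "(\<lambda>i. cinner (e j) (blinfun_apply (a i *\<^sub>R rank_one_proj (e i)) v))
      = (\<lambda>i. if i = j then of_real (a i) * cinner (e i) v else 0)"
    by (auto simp: blinfun.scaleR_left rank_one_proj_apply scaleR_scaleC cinner_scaleC_right orth)
  then show "(\<lambda>i. cinner (e j) (blinfun_apply (a i *\<^sub>R rank_one_proj (e i)) v))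
      sums (of_real (a j) * cinner (e j) v)"
    using sums_single[of j "\<lambda>i. of_real (a i) * cinner (e i) v"] by simp
qed

section \<open>Vanishing at the jumps\<close>

text \<open>To the right of \<open>s\<close> the product vanishes, and by continuity it vanishes at \<open>s\<close> too, where
  its value is \<open>a h(s)\<close>. The argument needs room to the right of \<open>s\<close> inside the interval, hence \<open>s < 1\<close>.\<close>

lemma coordinate_zero_at_jump:
  fixes h :: "real \<Rightarrow> complex"
  assumes cont: "continuous_on {0..1} (\<lambda>t. of_real (a * indicator {0..s} t) * h t)"
    and s: "0 \<le> s" "s < 1" and "a \<noteq> 0"
  shows "h s = 0"
proof -
  have "of_real (a * indicator {0..s} s) * h s = 0"
  proof (rule continuous_constant_on_closure[where S = "{s<..<1}"
        and f = "\<lambda>t. of_real (a * indicator {0..s} t) * h t"])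
    show "continuous_on (closure {s<..<1}) (\<lambda>t. of_real (a * indicator {0..s} t) * h t)"
      by (rule continuous_on_subset[OF cont]) (use s in auto)
    show "s \<in> closure {s<..<1}"
      using s by simp
  qed auto
  then show ?thesis
    using s \<open>a \<noteq> 0\<close> by simp
qed

text \<open>The value \<open>1\<close> may occur among the \<open>\<tau>\<^sub>i\<close>, and there membership in \<open>J\<close> imposes nothing. As \<open>1\<close>
  is not isolated in the interval, it can be discarded without losing density.\<close>

lemma dense_subset_below_right_end:
  fixes D :: "real set"
  assumes "{0..1} \<subseteq> closure D"
  shows "{0..1} \<subseteq> closure (D - {1})"
proof -
  have "closure D \<subseteq> closure (insert 1 (D - {1}))"
    by (rule closure_mono) auto
  then have "closure D \<subseteq> insert 1 (closure (D - {1}))"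
    by (simp only: closure_insert)
  then have "{0..1} - {1} \<subseteq> closure (D - {1})"
    using assms by blast
  then have "{0<..<1} \<subseteq> closure (D - {1})"
    by (rule order_trans[rotated]) auto
  then have "closure {0<..<1::real} \<subseteq> closure (D - {1})"
    by (rule closure_minimal) simp
  then show ?thesis by simp
qed

theorem lemma2p4:
  fixes e :: "nat \<Rightarrow> 'h::complex_hilbert"
    and \<tau> :: "nat \<Rightarrow> real"
    and X :: "real set"
    and f :: "real \<Rightarrow> 'h \<Rightarrow>\<^sub>L 'h"
    and J :: "(real \<Rightarrow> 'h \<Rightarrow>\<^sub>L 'h) set"
  assumes X: "X = {0..1}"
    and basis: "orthonormal_basis e"
    and tau_in: "range \<tau> \<subseteq> X"
    and tau_dense: "X \<subseteq> closure (range \<tau>)"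
    and f: "\<And>t. t \<in> X \<Longrightarrow>
      f t = (\<Sum>i. (1 / 2 ^ Suc i * indicator {0..\<tau> i} t) *\<^sub>R rank_one_proj (e i))"
    and J: "J = {x \<in> C_K X. (\<lambda>t. f t o\<^sub>L x t) \<in> C_K X}"
  shows "closed_right_ideal X J \<and> \<not> topologically_essential X J"
proof
  have orth: "cinner (e i) (e j) = (if i = j then 1 else 0)" for i j
    using basis by (simp add: orthonormal_basis_def)
  then have norm_e: "norm (e i) = 1" for i
    by (simp add: norm_eq_sqrt_cinner)
  define a :: "real \<Rightarrow> nat \<Rightarrow> real" where "a t i = 1 / 2 ^ Suc i * indicator {0..\<tau> i} t" 
    for t :: real and i
  have f_a: "f t = (\<Sum>i. a t i *\<^sub>R rank_one_proj (e i))" if "t \<in> X" for t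
    using f[OF that] by (simp add: a_def)
  have geom: "(\<lambda>i. 1 / 2 ^ Suc i :: real) sums 1"
    using power_half_series by (simp add: power_divide)
  have a_le: "\<bar>a t i\<bar> \<le> 1 / 2 ^ Suc i" for t i
    by (simp add: a_def indicator_def)
  have a_summable: "summable (\<lambda>i. \<bar>a t i\<bar>)" for t
    by (rule summable_comparison_test'[OF sums_summable[OF geom], of 0]) (use a_le in simp)
  have a_sum: "(\<Sum>i. \<bar>a t i\<bar>) \<le> 1" for t
    using suminf_le[OF a_le a_summable sums_summable[OF geom]] sums_unique[OF geom] by simp

  show "closed_right_ideal X J"
    unfolding J
  proof (rule closed_right_ideal_continuous_product)
    show "norm (f t) \<le> 1" if "t \<in> X" for t
      using rank_one_proj_diagonal_sums(2)[of e, OF norm_e a_summable[of t]] a_sum[of t]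
      by (simp add: f_a[OF that])
    show "blinfun_apply (f t) (c *\<^sub>C v) = c *\<^sub>C blinfun_apply (f t) v" if "t \<in> X" for t c v
      unfolding f_a[OF that] by (rule rank_one_proj_diagonal_sums(3)[OF norm_e a_summable])
  qed

  obtain u where u: "norm u = 1" "\<And>i. cinner (e i) u \<noteq> 0"
    using unit_vector_all_coordinates[OF orth] by blast
  define I where "I = {x \<in> C_K X. \<forall>t\<in>X. rank_one_proj u o\<^sub>L x t = x t}"
  have I_ideal: "closed_right_ideal X I"
    unfolding I_def by (intro closed_right_ideal_fixed_by_left_mult rank_one_proj_scaleC)
  have Pu: "blinfun_apply (rank_one_proj u) u = u"
    by (simp add: rank_one_proj_apply cinner_self u(1) flip: scaleR_scaleC[of 1, simplified])
  have "(\<lambda>t. if t \<in> X then rank_one_proj u else 0) \<in> I"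
  proof -
    have "continuous_on X (\<lambda>t. if t \<in> X then rank_one_proj u else 0)"
      by (simp cong: continuous_on_cong)
    moreover have "rank_one_proj u o\<^sub>L rank_one_proj u = rank_one_proj u"
      by (rule blinfun_eqI) (simp add: rank_one_proj_apply[of u "_ :: 'h"] cinner_scaleC_right
        cinner_self u(1))
    ultimately show ?thesis
      by (simp add: I_def C_K_def rank_one_proj_compact)
  qed
  moreover have "rank_one_proj u \<noteq> 0"
    using Pu u(1) by auto
  ultimately have "I \<noteq> {\<lambda>t. 0}"
    using X by (auto dest!: fun_cong[where x = 0])

  have "x = (\<lambda>t. 0)" if "x \<in> J" "x \<in> I" for x
  proof
    have x_cont: "continuous_on X x" and fx_cont: "continuous_on X (\<lambda>t. f t o\<^sub>L x t)"
      and x_outside: "\<And>t. t \<notin> X \<Longrightarrow> x t = 0"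
      using that by (auto simp: J C_K_def)
    have x_line: "x t v \<in> range (\<lambda>c. c *\<^sub>C u)" if "t \<in> X" for t v
    proof -
      have "x t v = blinfun_apply (rank_one_proj u) (x t v)"
        using \<open>x \<in> I\<close> that unfolding I_def
        by (metis (mono_tags, lifting) blinfun_apply_blinfun_compose mem_Collect_eq)
      then show ?thesis by (auto simp: rank_one_proj_apply)
    qed
    have zero_at_tau: "x (\<tau> i) = 0" if "\<tau> i \<noteq> 1" for i
    proof (rule blinfun_eqI)
      fix v
      have tau: "\<tau> i \<in> X" "0 \<le> \<tau> i" "\<tau> i < 1"
        using tau_in that by (auto simp: X subset_iff less_le)
      have "continuous_on X (\<lambda>t. cinner (e i) (blinfun_apply (f t o\<^sub>L x t) v))"
        by (intro bounded_linear.continuous_on[OF bounded_linear_cinner_right]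
            blinfun.continuous_on fx_cont continuous_on_const)
      moreover have "cinner (e i) (blinfun_apply (f t o\<^sub>L x t) v)
          = of_real (1 / 2 ^ Suc i * indicator {0..\<tau> i} t) * cinner (e i) (x t v)" if "t \<in> X" for t
        unfolding blinfun_apply_blinfun_compose f_a[OF that]
        by (subst cinner_rank_one_proj_diagonal[OF orth a_summable]) (simp add: a_def)
      ultimately have "continuous_on {0..1} (\<lambda>t. of_real (1 / 2 ^ Suc i * indicator {0..\<tau> i} t)
          * cinner (e i) (x t v))"
        unfolding X by (metis (no_types, lifting) continuous_on_cong)
      then have "cinner (e i) (x (\<tau> i) v) = 0"
        by (rule coordinate_zero_at_jump) (use tau in auto)
      moreover obtain c where c: "x (\<tau> i) v = c *\<^sub>C u"
        using x_line[OF tau(1), of v] by auto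
      ultimately have "c = 0"
        using u(2)[of i] by (simp add: cinner_scaleC_right)
      then show "x (\<tau> i) v = blinfun_apply 0 v"
        using c norm_scaleC[of 0 u] by simp
    qed
    have dense: "X \<subseteq> closure (range \<tau> - {1})"
      using dense_subset_below_right_end tau_dense by (simp add: X)
    have closure_X: "closure (range \<tau> - {1}) \<subseteq> X"
      using tau_in by (intro closure_minimal) (auto simp: X)
    show "x t = 0" for t
    proof (cases "t \<in> X")
      case True
      show ?thesis
      proof (rule continuous_constant_on_closure[where S = "range \<tau> - {1}" and f = x])
        show "continuous_on (closure (range \<tau> - {1})) x"
          using x_cont closure_X by (rule continuous_on_subset)
        show "t \<in> closure (range \<tau> - {1})"
          using True dense by blast
      qed (use zero_at_tau in auto)
    qed (rule x_outside)
  qed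
  then have "J \<inter> I = {\<lambda>t. 0}"
    using \<open>closed_right_ideal X J\<close> I_ideal by (auto simp: closed_right_ideal_def)
  then show "\<not> topologically_essential X J"
    using I_ideal \<open>I \<noteq> {\<lambda>t. 0}\<close> by (auto simp: topologically_essential_def)
qed

end
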